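(* Let $t\geq 2$ be an integer with $t\neq 2,6$, let $s$ be an integer with $2\leq s<t$, and let $m\geq 2$ be an integer. Then for every integer $c$ with $mt+s\leq c\leq mt^2+2s$ and $c\neq mt+s+1$, there exists a quantum Latin square of order $mt+s$ with cardinality $c$, except possibly when $m=2$, $s=2$ and $c$ is an odd integer in $[2t+2,\,2t^2+4]$ (that is, no assertion is made in this exceptional case).
   Context: A quantum Latin square of order $v$, QLS$(v)$, is a $v\times v$ array $\Phi=(|\Phi_{i,j}\rangle)$ whose entries are unit column vectors of $\mathbb{C}^v$ such that the entries of every row form an orthonormal basis of $\mathbb{C}^v$ and the entries of every column form an orthonormal basis of $\mathbb{C}^v$. Two unit vectors $|u\rangle,|w\rangle\in\mathbb{C}^v$ have the same global phase if $|u\rangle=e^{\mathrm{i}\theta}|w\rangle$ for some $\theta\in[0,2\pi)$; otherwise they are distinct (up to a global phase). The cardinality of a QLS$(v)$ is the number of its entries that are distinct up to a global phase, i.e. the number of classes of its $v^2$ entries under the relation "same global phase". *)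

theory Defs
  imports Complex_Main "Jordan_Normal_Form.VS_Connect"
begin

text \<open>
  Vectors of $C^v$ are the elements of \<^term>\<open>carrier_vec v :: complex vec set\<close>, and
  \<open>x \<bullet>c y\<close> is the Hermitian inner product (conjugate-linear in \<open>y\<close>).
  A family is indexed by \<open>0, \<dots>, v - 1\<close>; its values at other indices are irrelevant.
  The basis clause is redundant given the other two; it is there to match the definition literally.
\<close>

definition orthonormal_basis :: "nat \<Rightarrow> (nat \<Rightarrow> complex vec) \<Rightarrow> bool" where
  "orthonormal_basis v b \<longleftrightarrow>
     (\<forall>i<v. b i \<in> carrier_vec v) \<and>
     (\<forall>i<v. \<forall>j<v. b i \<bullet>c b j = (if i = j then 1 else 0)) \<and>
     vectorspace.basis class_ring (module_vec TYPE(complex) v) (b ` {..<v})"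

definition quantum_latin_square :: "nat \<Rightarrow> (nat \<Rightarrow> nat \<Rightarrow> complex vec) \<Rightarrow> bool" where
  "quantum_latin_square v \<Phi> \<longleftrightarrow>
     (\<forall>i<v. \<forall>j<v. \<Phi> i j \<in> carrier_vec v \<and> \<Phi> i j \<bullet>c \<Phi> i j = 1) \<and>
     (\<forall>i<v. orthonormal_basis v (\<lambda>j. \<Phi> i j)) \<and>
     (\<forall>j<v. orthonormal_basis v (\<lambda>i. \<Phi> i j))"

definition same_global_phase :: "complex vec \<Rightarrow> complex vec \<Rightarrow> bool" where
  "same_global_phase u w \<longleftrightarrow>
     (\<exists>\<theta>\<in>{0..<2*pi}. u = exp (\<i> * complex_of_real \<theta>) \<cdot>\<^sub>v w)"

definition qls_entries :: "nat \<Rightarrow> (nat \<Rightarrow> nat \<Rightarrow> complex vec) \<Rightarrow> complex vec set" where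
  "qls_entries v \<Phi> = {\<Phi> i j | i j. i < v \<and> j < v}"

definition qls_cardinality :: "nat \<Rightarrow> (nat \<Rightarrow> nat \<Rightarrow> complex vec) \<Rightarrow> nat" where
  "qls_cardinality v \<Phi> =
     card (qls_entries v \<Phi> //
       {(u, w). u \<in> qls_entries v \<Phi> \<and> w \<in> qls_entries v \<Phi> \<and> same_global_phase u w})"

end

theory Submission
  imports Defs "HOL-Number_Theory.Cong"
begin

text \<open>
  In a Latin square over an orthonormal basis, a set of cells that meets each line either in no cell or
  in exactly the symbols of a fixed set \<open>T\<close> may be rewritten in any other orthonormal basis of the span
  of \<open>T\<close>. Rotating \<open>n\<close> symbols in generic position in such a region adds \<open>n\<close> to the cardinality, where
  \<open>n\<close> can be anything but 1. Two orthogonal Latin squares of order \<open>t\<close> yield, by Wilson's construction,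
  a Latin square of order \<open>m t + s\<close> whose cells split into \<open>t\<^sup>2\<close> disjoint regions with \<open>m\<close> symbols and
  one region with \<open>s\<close> symbols.

  Only odd \<open>t\<close> is needed, so that the squares \<open>x + y\<close> and \<open>x + 2 y\<close> modulo \<open>t\<close> suffice and the existence
  of orthogonal squares of order congruent to 2 modulo 4 plays no role: for even \<open>t\<close> the order is
  rewritten as \<open>2 u + k\<close> with \<open>u\<close> odd and \<open>k\<close> small (or \<open>u = t + 1\<close> if \<open>m = 2\<close>), and the bound
  \<open>2 u\<^sup>2 + k + 1\<close> is large enough. The odd increments then come from a single region
  with 3 symbols.
\<close>

section \<open>Unitary rotations of a set of coordinates\<close>

text \<open>The matrix with rows \<open>b i\<close> times its conjugate transpose is the identity,
  so its determinant is nonzero. Its rows are then \<open>n\<close> independent vectors in dimension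
  \<open>n\<close>.\<close>

lemma orthonormal_basisI:
  fixes b :: "nat \<Rightarrow> complex vec"
  assumes carr: "\<And>i. i < n \<Longrightarrow> b i \<in> carrier_vec n"
    and orth: "\<And>i j. i < n \<Longrightarrow> j < n \<Longrightarrow> b i \<bullet>c b j = (if i = j then 1 else 0)"
  shows "orthonormal_basis n b"
proof -
  interpret vec_space "TYPE(complex)" n .
  define A where "A = mat n n (\<lambda>(i, j). b i $ j)"
  define B where "B = mat n n (\<lambda>(i, j). cnj (b j $ i))"
  have A: "A \<in> carrier_mat n n" and B: "B \<in> carrier_mat n n"
    by (auto simp: A_def B_def)
  have rowA: "row A i = b i" if "i < n" for i
    using that carr[OF that] by (auto simp: A_def intro!: eq_vecI)
  have "A * B = 1\<^sub>m n"
  proof (rule eq_matI)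
    fix i j assume ij: "i < dim_row (1\<^sub>m n :: complex mat)" "j < dim_col (1\<^sub>m n :: complex mat)"
    then have "col B j = conjugate (b j)"
      using carr[of j] by (auto simp: B_def intro!: eq_vecI)
    then show "(A * B) $$ (i, j) = 1\<^sub>m n $$ (i, j)"
      using ij A B rowA[of i] orth[of i j] by simp
  qed (use A B in auto)
  then have "det A * det B = 1"
    using det_mult[OF A B] by simp
  then have det: "det A \<noteq> 0"
    by auto
  have set_rows: "set (rows A) = b ` {..<n}"
    using A rowA by (force simp: rows_def)
  have inj: "inj_on b {..<n}"
  proof (rule inj_onI)
    fix i j assume "i \<in> {..<n}" "j \<in> {..<n}" "b i = b j"
    then show "i = j"
      using orth[of i i] orth[of i j] by (auto split: if_splits)
  qed
  have "basis (b ` {..<n})"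
  proof (rule dim_li_is_basis)
    show "\<not> lin_dep (b ` {..<n})"
      using lin_dep_rows_imp_det_0[OF A] det set_rows by auto
  qed (use carr inj in \<open>auto simp: dim_is_n card_image\<close>)
  then show ?thesis
    unfolding orthonormal_basis_def using carr orth by auto
qed

text \<open>Chosen so that \<open>1 + rotation_phase k = (k + 10 + \<i>) / (k + 10 - \<i>)\<close> lies on the unit circle.\<close>

definition rotation_phase :: "nat \<Rightarrow> complex" where
  "rotation_phase k = 2 * \<i> / (of_nat (k + 10) - \<i>)"

text \<open>This is \<open>(1 + z) * (1 + cnj z) = 1\<close> expanded, the form in which unitarity
  is used.\<close>

lemma rotation_phase_unitary:
  "rotation_phase k + cnj (rotation_phase k) + rotation_phase k * cnj (rotation_phase k) = 0"
proof -
  define p q where "p = of_nat (k + 10) - \<i>" and "q = of_nat (k + 10) + \<i>"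
  have nz: "p \<noteq> 0" "q \<noteq> 0"
    by (auto simp: p_def q_def complex_eq_iff)
  have phase: "rotation_phase k = 2 * \<i> / p" "cnj (rotation_phase k) = - (2 * \<i> / q)"
    by (simp_all add: rotation_phase_def p_def q_def)
  have "rotation_phase k + cnj (rotation_phase k) + rotation_phase k * cnj (rotation_phase k)
      = (2 * \<i> * (q - p) + 4) / (p * q)"
    unfolding phase(2) unfolding phase(1) using nz by (simp add: divide_simps) (simp add: algebra_simps)
  also have "2 * \<i> * (q - p) + 4 = 0"
    by (simp add: p_def q_def)
  finally show ?thesis by simp
qed

lemma norm_rotation_phase: "norm (rotation_phase k) = 2 / sqrt ((real (k + 10))\<^sup>2 + 1)"
proof -
  have "of_nat (k + 10) - \<i> = Complex (real (k + 10)) (- 1)"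
    by (simp add: complex_eq_iff)
  then show ?thesis
    unfolding rotation_phase_def norm_divide by (simp add: norm_mult complex_norm)
qed

text \<open>The bound 1/2 makes one coordinate of a rotated vector dominate all others; the shift by
  10 in the phase ensures it for every \<open>k\<close>.\<close>

lemma norm_rotation_phase_bounds: "0 < norm (rotation_phase k)" "norm (rotation_phase k) < 1/2"
proof -
  have "sqrt (4\<^sup>2) < sqrt ((real (k + 10))\<^sup>2 + 1)"
    using power_mono[of 4 "real (k + 10)" 2] by (intro real_sqrt_less_mono) simp
  then have gt: "4 < sqrt ((real (k + 10))\<^sup>2 + 1)"
    by (simp del: power2_eq_square)
  show "0 < norm (rotation_phase k)"
    unfolding norm_rotation_phase using gt by (intro divide_pos_pos) linarith+
  show "norm (rotation_phase k) < 1/2"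
    unfolding norm_rotation_phase using gt by (subst pos_divide_less_eq) linarith+
qed

text \<open>Global phases preserve moduli, so regions given different numbers stay
  distinguishable.\<close>

lemma inj_norm_rotation_phase:
  assumes "norm (rotation_phase k) = norm (rotation_phase l)"
  shows "k = l"
proof -
  have "(real (k + 10))\<^sup>2 = (real (l + 10))\<^sup>2"
    using assms unfolding norm_rotation_phase by simp
  then have "real (k + 10) = real (l + 10)"
    by (rule power2_eq_imp_eq) simp_all
  then show ?thesis by simp
qed

text \<open>Column \<open>a\<close> of \<open>I + (z / card T) J\<close>, where \<open>J\<close> is the all-ones matrix on \<open>T\<close>; this matrix is unitary
  as soon as \<open>1 + z\<close> has modulus 1.\<close>

definition rotated :: "'a set \<Rightarrow> complex \<Rightarrow> 'a \<Rightarrow> 'a \<Rightarrow> complex" where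
  "rotated T z a x = of_bool (x = a) + of_bool (x \<in> T) * z / of_nat (card T)"

text \<open>The all-ones matrix squares to \<open>n\<close> times itself, so the Gram matrix is the
  identity plus \<open>q + cnj q + n * q * cnj q\<close> times the all-ones matrix. This coefficient
  is \<open>(z + cnj z + z * cnj z) / n = 0\<close>.\<close>

lemma rotated_orthonormal:
  assumes "finite I" "T \<subseteq> I" "a \<in> T" "b \<in> T" and z: "z + cnj z + z * cnj z = 0"
  shows "(\<Sum>x\<in>I. rotated T z a x * cnj (rotated T z b x)) = of_bool (a = b)"
proof -
  define n q where "n = card T" and "q = z / of_nat n"
  have fin: "finite T" using assms finite_subset by blast
  have n: "n \<noteq> 0" using assms fin by (auto simp: n_def)
  have "(\<Sum>x\<in>I. rotated T z a x * cnj (rotated T z b x)) = (\<Sum>x\<in>T. rotated T z a x * cnj (rotated T z b x))"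
    using assms by (intro sum.mono_neutral_right) (auto simp: rotated_def)
  also have "\<dots> = (\<Sum>x\<in>T. of_bool (x = a) * of_bool (a = b) + (of_bool (x = a) * cnj q
      + of_bool (x = b) * q) + q * cnj q)"
    by (intro sum.cong) (auto simp: rotated_def n_def[symmetric] q_def algebra_simps)
  also have "\<dots> = of_bool (a = b) + (cnj q + q) + of_nat n * (q * cnj q)"
    using assms fin by (simp add: sum.distrib n_def of_bool_def if_distrib[of "\<lambda>x. x * _"] cong: if_cong)
  also have "\<dots> = of_bool (a = b) + (z + cnj z + z * cnj z) / of_nat n"
    using n by (simp add: q_def field_simps)
  finally show ?thesis using z by simp
qed

text \<open>The supports lie in the disjoint sets \<open>insert a T\<close> and
  \<open>insert b T'\<close>.\<close>

lemma rotated_disjoint: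
  assumes "a \<notin> T'" "b \<notin> T" "a \<noteq> b" "T \<inter> T' = {}"
  shows "rotated T z a x * cnj (rotated T' z' b x) = 0"
  using assms by (auto simp: rotated_def)

lemma sum_rotated_empty:
  assumes "finite I" "a \<in> I"
  shows "(\<Sum>x\<in>I. rotated {} z a x * cnj (rotated {} z a x)) = 1"
  using assms by (simp add: rotated_def of_bool_def if_distrib[of cnj] if_distrib[of "\<lambda>x. x * _"] cong: if_cong)

text \<open>The index \<open>a\<close>, the region \<open>T\<close> and the modulus of \<open>z\<close> can all be read off the moduli of the coordinates.\<close>

lemma norm_rotated_off_diag:
  assumes "x \<noteq> a"
  shows "norm (rotated T z a x) = of_bool (x \<in> T) * (norm z / real (card T))"
  using assms by (simp add: rotated_def norm_divide)

lemma norm_region_term_less: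
  fixes z :: complex
  assumes "norm z < 1/2"
  shows "norm (of_bool P * z / of_nat n) < 1/2"
proof (cases "n = 0 \<or> \<not> P")
  case False
  then have "norm z / real n \<le> norm z"
    using divide_left_mono[of 1 "real n" "norm z"] by simp
  with False assms show ?thesis by (simp add: norm_divide)
qed auto

lemma norm_rotated_diag:
  assumes "norm z < 1/2" shows "1/2 < norm (rotated T z a a)"
  using norm_region_term_less[OF assms, of "a \<in> T" "card T"]
    norm_triangle_ineq2[of 1 "- (of_bool (a \<in> T) * z / of_nat (card T))"]
  unfolding rotated_def by simp

lemma norm_rotated_off_diag_less:
  assumes "norm z < 1/2" "x \<noteq> a"
  shows "norm (rotated T z a x) < 1/2"
  using norm_region_term_less[OF assms(1), of "x \<in> T" "card T"] assms(2)
  by (simp add: rotated_def)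

text \<open>\<open>a\<close> is the only coordinate of modulus above 1/2.\<close>

lemma rotated_moduli_eq:
  assumes eq: "\<And>x. x \<in> I \<Longrightarrow> norm (rotated T z a x) = norm (rotated T' z' a' x)"
    and aI: "a \<in> I" and z: "norm z < 1/2" and z': "norm z' < 1/2"
  shows "a = a'"
proof (rule ccontr)
  assume "a \<noteq> a'"
  then show False
    using eq[OF aI] norm_rotated_diag[OF z, of T a] norm_rotated_off_diag_less[OF z', of a a' T'] by simp
qed

text \<open>Off \<open>a\<close> the modulus is \<open>norm z / card T\<close> on the region and 0
  elsewhere. A nonempty region has a symbol besides \<open>a\<close>, where membership and the
  modulus of \<open>z\<close> are visible.\<close>

lemma rotated_moduli_eq_region:
  assumes eq: "\<And>x. x \<in> I \<Longrightarrow> norm (rotated T z a x) = norm (rotated T' z' a x)"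
    and T: "T = {} \<or> a \<in> T \<and> card T \<ge> 2" "T \<subseteq> I"
    and T': "T' = {} \<or> a \<in> T' \<and> card T' \<ge> 2" "T' \<subseteq> I"
    and z: "z \<noteq> 0" "z' \<noteq> 0"
  shows "T = T' \<and> (T \<noteq> {} \<longrightarrow> norm z = norm z')"
proof -
  have card: "card T \<noteq> 0" if "x \<in> T" for x using that T(1) by auto
  have card': "card T' \<noteq> 0" if "x \<in> T'" for x using that T'(1) by auto
  have off: "of_bool (x \<in> T) * (norm z / real (card T)) = of_bool (x \<in> T') * (norm z' / real (card T'))"
    if "x \<in> I" "x \<noteq> a" for x
    using eq[OF that(1)] norm_rotated_off_diag[OF that(2)] by metis
  have iff: "x \<in> T \<longleftrightarrow> x \<in> T'" if "x \<noteq> a" for x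
  proof (cases "x \<in> I")
    case True
    then show ?thesis
      using off[OF True that] card[of x] card'[of x] z by (cases "x \<in> T"; cases "x \<in> T'") auto
  qed (use T T' in auto)
  have witness: "\<exists>x\<in>U. x \<noteq> a" if "card U \<ge> 2" for U
  proof (rule ccontr)
    assume "\<not> ?thesis"
    then have "U \<subseteq> {a}" by auto
    then have "card U \<le> 1" using card_mono[of "{a}" U] by simp
    with that show False by simp
  qed
  have TT': "T = T'"
  proof (cases "T = {}")
    case True
    then show ?thesis using T'(1) iff witness[of T'] by auto
  next
    case False
    then obtain x where "x \<in> T" "x \<noteq> a" using witness[of T] T(1) by auto
    then have "a \<in> T'" "a \<in> T" using iff[of x] T'(1) T(1) by auto
    then have "x \<in> T \<longleftrightarrow> x \<in> T'" for x using iff[of x] by (cases "x = a") auto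
    then show ?thesis by auto
  qed
  have "norm z = norm z'" if nonempty: "T \<noteq> {}"
  proof -
    obtain x where x: "x \<in> T" "x \<noteq> a" using witness[of T] T(1) nonempty by auto
    then show ?thesis using off[of x] TT' T(2) card[of x] by auto
  qed
  with TT' show ?thesis by simp
qed

section \<open>Rotating regions of a Latin square\<close>

lemma same_global_phase_refl: "same_global_phase u u"
  unfolding same_global_phase_def by (intro bexI[of _ 0]) auto

lemma qls_cardinality_eq_card_entries:
  assumes "\<And>u w. u \<in> qls_entries n \<Phi> \<Longrightarrow> w \<in> qls_entries n \<Phi> \<Longrightarrow> same_global_phase u w \<Longrightarrow> u = w"
  shows "qls_cardinality n \<Phi> = card (qls_entries n \<Phi>)"
proof -
  have "{(u, w). u \<in> qls_entries n \<Phi> \<and> w \<in> qls_entries n \<Phi> \<and> same_global_phase u w}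
      = Id_on (qls_entries n \<Phi>)" (is "?R = _")
    using assms same_global_phase_refl by auto
  moreover have "qls_entries n \<Phi> // Id_on (qls_entries n \<Phi>) = (\<lambda>u. {u}) ` qls_entries n \<Phi>"
    unfolding quotient_def by auto
  ultimately show ?thesis
    unfolding qls_cardinality_def by (simp add: card_image)
qed

lemma same_global_phase_norm_eq:
  assumes "same_global_phase u w" "i < dim_vec w"
  shows "norm (u $ i) = norm (w $ i)"
  using assms unfolding same_global_phase_def by (auto simp: norm_mult)

text \<open>Two cells of a line either share their region and its rotation, or have vectors with
  disjoint supports. \<open>T = T' = {}\<close> covers two cells outside all regions.\<close>

lemma sum_rotated_eq:
  assumes fin: "finite I" and in_I: "a \<in> I" "b \<in> I"
    and T: "T \<subseteq> I" "T = {} \<or> a \<in> T" and T': "T' = {} \<or> b \<in> T'"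
    and z: "z + cnj z + z * cnj z = 0"
    and cases: "T = T' \<and> z = z' \<or> T \<inter> T' = {} \<and> a \<noteq> b \<and> a \<notin> T' \<and> b \<notin> T"
  shows "(\<Sum>x\<in>I. rotated T z a x * cnj (rotated T' z' b x)) = of_bool (a = b)"
  using cases
proof
  assume eq: "T = T' \<and> z = z'"
  show ?thesis
  proof (cases "T = {}")
    case True
    then show ?thesis
      using eq sum_rotated_empty[OF fin in_I(1)] by (cases "a = b") (simp_all add: rotated_disjoint)
  next
    case False
    then show ?thesis
      using eq T T' rotated_orthonormal[OF fin, of T a b z] z by blast
  qed
next
  assume "T \<inter> T' = {} \<and> a \<noteq> b \<and> a \<notin> T' \<and> b \<notin> T"
  then show ?thesis by (simp add: rotated_disjoint)
qed

section \<open>Regions of a Latin square\<close>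

definition latin_on :: "'a set \<Rightarrow> ('a \<Rightarrow> 'a \<Rightarrow> 'a) \<Rightarrow> bool" where
  "latin_on I L \<longleftrightarrow> (\<forall>i\<in>I. L i ` I \<subseteq> I \<and> inj_on (L i) I \<and> inj_on (\<lambda>j. L j i) I)"

lemma latin_on_transpose: "latin_on I L \<Longrightarrow> latin_on I (\<lambda>i j. L j i)"
  unfolding latin_on_def by auto

text \<open>Cells with \<open>g i j = Some r\<close> form the region \<open>r\<close>, with symbols \<open>T r\<close>; every line that
  meets the region has all occurrences of \<open>T r\<close> inside the region. Hence the symbols of \<open>T r\<close>
  may be replaced there by any orthonormal basis of their span.\<close>

definition row_regions :: "'a set \<Rightarrow> ('a \<Rightarrow> 'a \<Rightarrow> 'a) \<Rightarrow> ('a \<Rightarrow> 'a \<Rightarrow> 'b option) \<Rightarrow> ('b \<Rightarrow> 'a set) \<Rightarrow> bool" where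
  "row_regions I L g T \<longleftrightarrow> (\<forall>i\<in>I. \<forall>j\<in>I. \<forall>r. g i j = Some r \<longrightarrow>
     L i j \<in> T r \<and> T r \<subseteq> I \<and> (\<forall>j'\<in>I. L i j' \<in> T r \<longrightarrow> g i j' = Some r))"

lemma row_regionsD:
  assumes "row_regions I L g T" "i \<in> I" "j \<in> I" "g i j = Some r"
  shows "L i j \<in> T r" "T r \<subseteq> I" "j' \<in> I \<Longrightarrow> L i j' \<in> T r \<Longrightarrow> g i j' = Some r"
  using assms unfolding row_regions_def by blast+

definition region_symbols :: "('b \<Rightarrow> 'a set) \<Rightarrow> 'b option \<Rightarrow> 'a set" where
  "region_symbols T r = (case r of None \<Rightarrow> {} | Some r \<Rightarrow> T r)"

text \<open>The default index 0 lets unitarity and the bounds of \<open>rotation_phase\<close> hold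
  at every cell.\<close>

definition region_phase :: "('b \<Rightarrow> nat) \<Rightarrow> 'b option \<Rightarrow> complex" where
  "region_phase e r = rotation_phase (case r of None \<Rightarrow> 0 | Some r \<Rightarrow> e r)"

text \<open>Cells with equal \<open>g\<close> share their rotation. For different values of
  \<open>g\<close>, closure of regions along the row makes the supports disjoint.\<close>

lemma row_orthonormal:
  assumes fin: "finite I" and lat: "latin_on I L" and reg: "row_regions I L g T"
    and I: "i \<in> I" "j \<in> I" "j' \<in> I"
  shows "(\<Sum>x\<in>I. rotated (region_symbols T (g i j)) (region_phase e (g i j)) (L i j) x *
      cnj (rotated (region_symbols T (g i j')) (region_phase e (g i j')) (L i j') x)) = of_bool (j = j')"
proof -
  have L_in: "L i k \<in> I" if "k \<in> I" for k
    using lat I(1) that unfolding latin_on_def by auto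
  have inj: "inj_on (L i) I"
    using lat I(1) unfolding latin_on_def by auto
  have surj: "L i ` I = I"
    using inj L_in fin by (intro endo_inj_surj) auto
  have r: "L i k \<in> T r" "T r \<subseteq> I" if "g i k = Some r" "k \<in> I" for k r
    using row_regionsD[OF reg I(1)] that by blast+
  have closed: "g i k' = Some r" if "g i k = Some r" "L i k' \<in> T r" "k \<in> I" "k' \<in> I" for k k' r
    using row_regionsD(3)[OF reg I(1)] that by blast
  have "(\<Sum>x\<in>I. rotated (region_symbols T (g i j)) (region_phase e (g i j)) (L i j) x *
      cnj (rotated (region_symbols T (g i j')) (region_phase e (g i j')) (L i j') x)) = of_bool (L i j = L i j')"
  proof (rule sum_rotated_eq[OF fin L_in L_in])
    let ?s = "\<lambda>k. region_symbols T (g i k)"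
    show "?s j = ?s j' \<and> region_phase e (g i j) = region_phase e (g i j') \<or>
        ?s j \<inter> ?s j' = {} \<and> L i j \<noteq> L i j' \<and> L i j \<notin> ?s j' \<and> L i j' \<notin> ?s j"
    proof (cases "g i j = g i j'")
      case False
      have notin: "L i k' \<notin> ?s k" if "g i k \<noteq> g i k'" "k \<in> I" "k' \<in> I" for k k'
        using closed[of k _ k'] that by (auto simp: region_symbols_def split: option.splits)
      have "?s j \<inter> ?s j' = {}"
      proof (rule ccontr)
        assume "?s j \<inter> ?s j' \<noteq> {}"
        then obtain x r r' where x: "x \<in> T r" "x \<in> T r'" "g i j = Some r" "g i j' = Some r'"
          by (auto simp: region_symbols_def split: option.splits)
        \<comment> \<open>The row is a permutation, so the common symbol occurs in it; closure would
          put that cell into both regions.\<close>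
        then obtain k where "k \<in> I" "L i k = x"
          using surj r(2)[of j r] I by (metis imageE subsetD)
        with x closed[of j r k] closed[of j' r' k] I False show False by auto
      qed
      moreover have "L i j \<noteq> L i j'" using inj I False by (auto dest: inj_onD)
      ultimately show ?thesis using notin[of j j'] notin[of j' j] False I by auto
    qed auto
  qed (use I r rotation_phase_unitary in \<open>auto simp: region_symbols_def region_phase_def split: option.splits\<close>)
  also have "\<dots> = of_bool (j = j')"
    using inj I by (auto dest: inj_onD)
  finally show ?thesis .
qed

text \<open>The moduli of the coordinates of an entry determine its symbol and its region, so
  entries up to phase correspond to the pairs \<open>(g i j, L i j)\<close>.\<close>

lemma qls_of_regions:
  fixes I :: "'a set" and g :: "'a \<Rightarrow> 'a \<Rightarrow> 'b option"
  assumes fin: "finite I" and lat: "latin_on I L"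
    and rows: "row_regions I L g T" and cols: "row_regions I (\<lambda>i j. L j i) (\<lambda>i j. g j i) T"
    and two: "\<And>i j r. i \<in> I \<Longrightarrow> j \<in> I \<Longrightarrow> g i j = Some r \<Longrightarrow> card (T r) \<ge> 2"
  shows "\<exists>\<Phi>. quantum_latin_square (card I) \<Phi> \<and>
    qls_cardinality (card I) \<Phi> = card ((\<lambda>(i, j). (g i j, L i j)) ` (I \<times> I))"
proof -
  define n where "n = card I"
  obtain h where "bij_betw h {0..<n} I"
    using ex_bij_betw_nat_finite[OF fin] n_def by auto
  then have h: "bij_betw h {..<n} I" by (simp add: atLeast0LessThan)
  then have h_in: "h k \<in> I" if "k < n" for k using that by (auto simp: bij_betw_def)
  have h_eq: "h k = h l \<longleftrightarrow> k = l" if "k < n" "l < n" for k l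
    using that h by (auto simp: bij_betw_def dest: inj_onD)
  have h_ex: "\<exists>k<n. h k = x" if "x \<in> I" for x
    using that h by (auto simp: bij_betw_def)
  \<comment> \<open>Regions are numbered injectively so that their phases have different
    moduli.\<close>
  have "finite (the ` (\<lambda>(i, j). g i j) ` (I \<times> I))" (is "finite ?U") using fin by auto
  then obtain e :: "'b \<Rightarrow> nat" where e: "inj_on e ?U"
    using finite_imp_inj_to_nat_seg[of ?U] by metis
  have U: "r \<in> ?U" if "g i j = Some r" "i \<in> I" "j \<in> I" for i j r
    using that by (force simp: image_iff)
  define W where "W p a = rotated (region_symbols T p) (region_phase e p) a" for p a
  define \<Phi> where "\<Phi> i j = vec n (\<lambda>x. W (g (h i) (h j)) (L (h i) (h j)) (h x))" for i j
  have ip: "\<Phi> i j \<bullet>c \<Phi> i' j' = (\<Sum>x\<in>I. W (g (h i) (h j)) (L (h i) (h j)) x * cnj (W (g (h i') (h j')) (L (h i') (h j')) x))"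
    for i j i' j'
  proof -
    have "\<Phi> i j \<bullet>c \<Phi> i' j' = (\<Sum>x<n. W (g (h i) (h j)) (L (h i) (h j)) (h x) * cnj (W (g (h i') (h j')) (L (h i') (h j')) (h x)))"
      by (simp add: \<Phi>_def scalar_prod_def atLeast0LessThan)
    also have "\<dots> = (\<Sum>x\<in>I. W (g (h i) (h j)) (L (h i) (h j)) x * cnj (W (g (h i') (h j')) (L (h i') (h j')) x))"
      by (rule sum.reindex_bij_betw[OF h])
    finally show ?thesis .
  qed
  have row: "\<Phi> i j \<bullet>c \<Phi> i j' = (if j = j' then 1 else 0)" if "i < n" "j < n" "j' < n" for i j j'
    unfolding ip W_def using row_orthonormal[OF fin lat rows] h_in h_eq that by simp
  have col: "\<Phi> j i \<bullet>c \<Phi> j' i = (if j = j' then 1 else 0)" if "i < n" "j < n" "j' < n" for i j j'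
    unfolding ip W_def using row_orthonormal[OF fin latin_on_transpose[OF lat] cols] h_in h_eq that by simp
  have qls: "quantum_latin_square n \<Phi>"
    unfolding quantum_latin_square_def
    by (intro conjI allI impI orthonormal_basisI) (use row col in \<open>auto simp: \<Phi>_def\<close>)
  define lab where "lab i j = (g i j, L i j)" for i j
  have phase_inj: "lab (h i) (h j) = lab (h i') (h j')"
    if lt: "i < n" "j < n" "i' < n" "j' < n" and ph: "same_global_phase (\<Phi> i j) (\<Phi> i' j')" for i j i' j'
  proof -
    let ?p = "g (h i) (h j)" and ?q = "g (h i') (h j')" and ?a = "L (h i) (h j)" and ?b = "L (h i') (h j')"
    have eq: "norm (W ?p ?a x) = norm (W ?q ?b x)" if "x \<in> I" for x
      using same_global_phase_norm_eq[OF ph] h_ex[OF that] by (auto simp: \<Phi>_def)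
    have a: "?a \<in> I" using lat lt h_in by (auto simp: latin_on_def)
    have ab: "?a = ?b"
      using eq unfolding W_def
      by (rule rotated_moduli_eq[OF _ a]) (simp_all only: region_phase_def norm_rotation_phase_bounds)
    have sym: "S \<subseteq> I \<and> (S = {} \<and> g (h k) (h l) = None \<or>
        L (h k) (h l) \<in> S \<and> card S \<ge> 2 \<and> g (h k) (h l) \<noteq> None)"
      if "S = region_symbols T (g (h k) (h l))" "k < n" "l < n" for k l S
    proof (cases "g (h k) (h l)")
      case (Some r)
      then show ?thesis
        using row_regionsD(1,2)[OF rows h_in h_in Some] two[OF h_in h_in Some] that
        by (simp add: region_symbols_def)
    qed (simp add: that region_symbols_def)
    define S S' where "S = region_symbols T ?p" and "S' = region_symbols T ?q"
    note sym1 = sym[OF S_def lt(1,2)] and sym2 = sym[OF S'_def lt(3,4)]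
    have nz: "rotation_phase k \<noteq> 0" for k using norm_rotation_phase_bounds(1)[of k] by auto
    have SS': "S = S' \<and> (S \<noteq> {} \<longrightarrow> norm (region_phase e ?p) = norm (region_phase e ?q))"
    proof (rule rotated_moduli_eq_region)
      show "norm (rotated S (region_phase e ?p) ?a x) = norm (rotated S' (region_phase e ?q) ?a x)"
        if "x \<in> I" for x
        using eq[OF that] ab by (simp add: W_def S_def S'_def)
    qed (use sym1 sym2 ab in \<open>auto simp: region_phase_def nz\<close>)
    have "?p = ?q"
    proof (cases ?p)
      case None
      then show ?thesis using SS' sym1 sym2 by auto
    next
      case (Some r)
      then obtain r' where Some': "?q = Some r'" using SS' sym1 sym2 by (cases ?q) auto
      \<comment> \<open>Different regions may have the same symbols; the modulus of the phase tells
        them apart.\<close>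
      have "norm (rotation_phase (e r)) = norm (rotation_phase (e r'))"
        using SS' sym1 Some Some' by (auto simp: region_phase_def)
      then have "e r = e r'" by (rule inj_norm_rotation_phase)
      moreover have "r \<in> ?U" "r' \<in> ?U" using U Some Some' h_in lt by blast+
      ultimately have "r = r'" using e by (simp add: inj_onD)
      then show ?thesis using Some Some' by simp
    qed
    with ab show ?thesis by (simp add: lab_def)
  qed
  define V where "V p = vec n (\<lambda>x. case_prod W p (h x))" for p
  have \<Phi>_V: "\<Phi> i j = V (lab (h i) (h j))" for i j
    by (simp add: \<Phi>_def lab_def V_def)
  let ?P = "(\<lambda>(i, j). lab i j) ` (I \<times> I)"
  have P: "p \<in> ?P \<longleftrightarrow> (\<exists>i<n. \<exists>j<n. p = lab (h i) (h j))" for p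
  proof
    assume "p \<in> ?P"
    then obtain x y where "x \<in> I" "y \<in> I" "p = lab x y" by auto
    then show "\<exists>i<n. \<exists>j<n. p = lab (h i) (h j)" using h_ex by metis
  qed (use h_in in auto)
  have entries: "qls_entries n \<Phi> = V ` ?P"
  proof (rule Set.set_eqI)
    show "u \<in> qls_entries n \<Phi> \<longleftrightarrow> u \<in> V ` ?P" for u
      unfolding qls_entries_def \<Phi>_V image_iff[of u V] Bex_def P by blast
  qed
  define P where "P = ?P"
  have V_eq: "p = q" if "p \<in> ?P" "q \<in> ?P" "same_global_phase (V p) (V q)" for p q
    using that phase_inj unfolding P \<Phi>_V by blast
  have "inj_on V ?P"
    by (rule inj_onI) (metis V_eq same_global_phase_refl)
  then have "card (qls_entries n \<Phi>) = card ?P"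
    unfolding entries by (rule card_image)
  moreover have "qls_cardinality n \<Phi> = card (qls_entries n \<Phi>)"
  proof (rule qls_cardinality_eq_card_entries)
    fix u w assume "u \<in> qls_entries n \<Phi>" "w \<in> qls_entries n \<Phi>" and ph: "same_global_phase u w"
    then obtain p q where p: "p \<in> P" "u = V p" and q: "q \<in> P" "w = V q"
      unfolding entries P_def[symmetric] by (elim imageE) (rule that)
    show "u = w" using V_eq[OF p(1)[unfolded P_def] q(1)[unfolded P_def]] ph p(2) q(2) by simp
  qed
  ultimately have "qls_cardinality n \<Phi> = card ?P" by simp
  with qls show ?thesis unfolding lab_def n_def by (intro exI[of _ \<Phi>] conjI)
qed

section \<open>Distributing an increment over the regions\<close>

text \<open>Induction over \<open>R\<close> always keeps \<open>r0\<close>, whose capacity of at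
  least 3 is the slack that avoids a remainder of 1.\<close>

lemma sum_with_bounds_insert:
  fixes cap :: "'r \<Rightarrow> nat"
  assumes "finite R" "r0 \<notin> R" "cap r0 \<ge> 3" "\<And>r. r \<in> R \<Longrightarrow> cap r \<ge> 2"
    and "x \<noteq> 1" "x \<le> sum cap (insert r0 R)"
  shows "\<exists>n. (\<forall>r\<in>insert r0 R. n r \<le> cap r \<and> n r \<noteq> 1) \<and> sum n (insert r0 R) = x"
  using assms
proof (induction R arbitrary: x rule: finite_induct)
  case empty
  then show ?case by (intro exI[of _ "\<lambda>_. x"]) auto
next
  case (insert r R)
  let ?R = "insert r0 R"
  have ge3: "sum cap ?R \<ge> 3" using insert by simp
  obtain d where d: "d \<noteq> 1" "d \<le> cap r" "d \<le> x" "x - d \<noteq> 1" "x - d \<le> sum cap ?R"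
  proof -
    \<comment> \<open>A total that fits into \<open>?R\<close> takes nothing from \<open>r\<close>.
      An excess of 1 is replaced by 2, leaving \<open>sum cap ?R - 1\<close>, which is at least 2. A
      larger excess goes to \<open>r\<close> as it is.\<close>
    consider "x \<le> sum cap ?R" | "x = sum cap ?R + 1" | "x \<ge> sum cap ?R + 2" by linarith
    then show thesis
    proof cases
      case 1
      then show thesis using insert.prems by (intro that[of 0]) auto
    next
      case 2
      then show thesis using insert.prems(3)[of r] ge3 by (intro that[of 2]) auto
    next
      case 3
      then show thesis using insert.prems insert.hyps ge3 by (intro that[of "x - sum cap ?R"]) auto
    qed
  qed
  obtain n where n: "\<forall>r\<in>?R. n r \<le> cap r \<and> n r \<noteq> 1" "sum n ?R = x - d"
    using insert.IH[of "x - d"] insert.prems d by auto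
  let ?n = "n(r := d)"
  have "r \<notin> ?R" using insert by auto
  then have "sum ?n ?R = sum n ?R" by (intro sum.cong) auto
  then have "sum ?n (insert r ?R) = x" using n(2) d(3) \<open>r \<notin> ?R\<close> insert.hyps(1) by simp
  moreover have "\<forall>q\<in>insert r ?R. ?n q \<le> cap q \<and> ?n q \<noteq> 1" using n(1) d by auto
  ultimately show ?case by (intro exI[of _ ?n]) (simp add: insert_commute)
qed

lemma sum_with_bounds:
  fixes cap :: "'r \<Rightarrow> nat"
  assumes "finite R" "r0 \<in> R" "cap r0 \<ge> 3" "\<And>r. r \<in> R \<Longrightarrow> cap r \<ge> 2"
    and "x \<noteq> 1" "x \<le> sum cap R"
  shows "\<exists>n. (\<forall>r\<in>R. n r \<le> cap r \<and> n r \<noteq> 1) \<and> sum n R = x"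
  using sum_with_bounds_insert[of "R - {r0}" r0 cap x] assms by (simp add: insert_absorb)

text \<open>Two units go to each of \<open>x div 2\<close> indices. This serves the case where all
  capacities are 2 and only even totals arise.\<close>

lemma even_sum_with_bounds:
  fixes cap :: "'r \<Rightarrow> nat"
  assumes "finite R" "even x" "x \<le> 2 * card R"
  shows "\<exists>n. (\<forall>r\<in>R. n r \<le> 2 \<and> n r \<noteq> (1::nat)) \<and> sum n R = x"
proof -
  have "x div 2 \<le> card R" using assms by simp
  then obtain U where U: "U \<subseteq> R" "card U = x div 2"
    using obtain_subset_with_card_n by metis
  have "(\<Sum>r\<in>R. if r \<in> U then 2 else 0) = 2 * card (R \<inter> U)"
    using assms by (simp add: sum.If_cases Int_def)
  also have "\<dots> = x" using U assms(2) by (simp add: Int_absorb1)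
  finally show ?thesis
    by (intro exI[of _ "\<lambda>r. if r \<in> U then 2 else 0"]) auto
qed

text \<open>Only \<open>n r\<close> symbols of the region \<open>r\<close> are rotated. By
  \<open>kept\<close> every symbol survives unrotated, giving \<open>card I\<close> classes, and
  each region adds its \<open>n r\<close> rotated vectors. The value 1 is excluded since rotating
  one symbol would only change its phase.\<close>

lemma qls_of_partial_regions:
  fixes I :: "'a set" and \<rho> :: "'a \<Rightarrow> 'a \<Rightarrow> 'b option"
  assumes fin: "finite I" "finite R" and lat: "latin_on I L"
    and rows: "row_regions I L \<rho> S" and cols: "row_regions I (\<lambda>i j. L j i) (\<lambda>i j. \<rho> j i) S"
    and n: "\<And>r. r \<in> R \<Longrightarrow> n r \<le> card (S r) \<and> n r \<noteq> 1"
    and realized: "\<And>r a. r \<in> R \<Longrightarrow> a \<in> S r \<Longrightarrow> \<exists>i\<in>I. \<exists>j\<in>I. \<rho> i j = Some r \<and> L i j = a"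
    and kept: "\<And>a. a \<in> I \<Longrightarrow> \<exists>i\<in>I. \<exists>j\<in>I. \<rho> i j \<notin> Some ` R \<and> L i j = a"
  shows "\<exists>\<Phi>. quantum_latin_square (card I) \<Phi> \<and> qls_cardinality (card I) \<Phi> = card I + sum n R"
proof -
  have "\<exists>T. T \<subseteq> S r \<and> card T = n r \<and> finite T" if "r \<in> R" for r
    using n[OF that] obtain_subset_with_card_n[of "n r" "S r"] by metis
  then obtain T0 where T0: "\<And>r. r \<in> R \<Longrightarrow> T0 r \<subseteq> S r \<and> card (T0 r) = n r \<and> finite (T0 r)"
    by metis
  define T where "T r = (if r \<in> R then T0 r else {})" for r
  have T: "T r \<subseteq> S r" "a \<in> T r \<Longrightarrow> r \<in> R" "r \<in> R \<Longrightarrow> card (T r) = n r" "finite (T r)" for r a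
    using T0 by (auto simp: T_def split: if_splits)
  define g where "g i j = (case \<rho> i j of None \<Rightarrow> None | Some r \<Rightarrow> if L i j \<in> T r then Some r else None)" for i j
  have g_Some: "g i j = Some r \<longleftrightarrow> \<rho> i j = Some r \<and> L i j \<in> T r" for i j r
    by (auto simp: g_def split: option.splits)
  have two: "card (T r) \<ge> 2" if "a \<in> T r" for a r
  proof -
    have "card (T r) \<noteq> 0" using that T(4)[of r] by auto
    moreover have "card (T r) \<noteq> 1" using n T(2)[OF that] T(3) by simp
    ultimately show ?thesis by linarith
  qed
  \<comment> \<open>Closure passes to subsets of the symbols, on the cells that show them.\<close>
  have restrict: "row_regions I L' g' T"
    if reg: "row_regions I L' \<rho>' S" and g': "\<And>i j r. g' i j = Some r \<longleftrightarrow> \<rho>' i j = Some r \<and> L' i j \<in> T r"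
    for L' \<rho>' g'
    unfolding row_regions_def g' using row_regionsD(2,3)[OF reg] T(1) by (meson subsetD subset_trans)
  have lab: "(\<lambda>(i, j). (g i j, L i j)) ` (I \<times> I) = Pair None ` I \<union> (\<Union>r\<in>R. Pair (Some r) ` T r)" (is "?lab = ?rhs")
  proof (intro equalityI subsetI)
    fix p assume "p \<in> ?lab"
    then obtain i j where ij: "i \<in> I" "j \<in> I" "p = (g i j, L i j)" by auto
    then have "L i j \<in> I" using lat by (auto simp: latin_on_def)
    show "p \<in> ?rhs"
    proof (cases "g i j")
      case None
      then show ?thesis using ij \<open>L i j \<in> I\<close> by simp
    next
      case (Some r)
      then have "L i j \<in> T r" using g_Some[of i j r] by simp
      then show ?thesis using ij Some T(2) by (intro UnI2 UN_I[of r]) auto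
    qed
  next
    fix p assume "p \<in> ?rhs"
    then show "p \<in> ?lab"
    proof
      assume "p \<in> Pair None ` I"
      then obtain a where a: "a \<in> I" "p = (None, a)" by auto
      then obtain i j where ij: "i \<in> I" "j \<in> I" "\<rho> i j \<notin> Some ` R" "L i j = a" using kept by blast
      then have "g i j = None" using T(2) g_Some[of i j] by (cases "g i j") auto
      then show ?thesis using a ij by (intro image_eqI[of _ _ "(i, j)"]) auto
    next
      assume "p \<in> (\<Union>r\<in>R. Pair (Some r) ` T r)"
      then obtain r a where r: "r \<in> R" "a \<in> T r" "p = (Some r, a)" by auto
      then obtain i j where ij: "i \<in> I" "j \<in> I" "\<rho> i j = Some r" "L i j = a"
        using realized T(1) by blast
      then have "g i j = Some r" using r g_Some by simp
      then show ?thesis using r ij by (intro image_eqI[of _ _ "(i, j)"]) auto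
    qed
  qed
  have "card ?rhs = card (Pair (None :: 'b option) ` I) + card (\<Union>r\<in>R. Pair (Some r) ` T r)"
    using fin T(4) by (intro card_Un_disjoint) auto
  also have "card (\<Union>r\<in>R. Pair (Some r) ` T r) = (\<Sum>r\<in>R. card (Pair (Some r) ` T r))"
    using fin T(4) by (intro card_UN_disjoint) auto
  also have "\<dots> = sum n R"
    using T(3) by (intro sum.cong) (auto simp: card_image inj_on_def)
  also have "card (Pair (None :: 'b option) ` I) = card I"
    by (simp add: card_image inj_on_def)
  finally have "card ?lab = card I + sum n R" unfolding lab .
  moreover have "\<exists>\<Phi>. quantum_latin_square (card I) \<Phi> \<and> qls_cardinality (card I) \<Phi> = card ?lab"
    by (rule qls_of_regions[OF fin(1) lat restrict[OF rows g_Some] restrict[OF cols g_Some]])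
      (use g_Some two in blast)
  ultimately show ?thesis by simp
qed

section \<open>Wilson's construction\<close>

definition orthogonal_squares :: "nat \<Rightarrow> (nat \<Rightarrow> nat \<Rightarrow> nat) \<Rightarrow> (nat \<Rightarrow> nat \<Rightarrow> nat) \<Rightarrow> bool" where
  "orthogonal_squares t A B \<longleftrightarrow> latin_on {..<t} A \<and> latin_on {..<t} B \<and>
     inj_on (\<lambda>(x, y). (A x y, B x y)) ({..<t} \<times> {..<t})"

text \<open>Transposition reduces the statements on columns to those on rows.\<close>

lemma orthogonal_squares_transpose:
  assumes "orthogonal_squares t A B"
  shows "orthogonal_squares t (\<lambda>x y. A y x) (\<lambda>x y. B y x)"
proof -
  have "inj_on (\<lambda>(x, y). (A y x, B y x)) ({..<t} \<times> {..<t})"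
  proof (rule inj_onI, clarsimp)
    fix x y x' y' assume "x < t" "y < t" "x' < t" "y' < t" "A y x = A y' x'" "B y x = B y' x'"
    then show "x = x' \<and> y = y'"
      using assms inj_onD[of "\<lambda>(x, y). (A x y, B x y)" "{..<t} \<times> {..<t}" "(y, x)" "(y', x')"]
      unfolding orthogonal_squares_def by simp
  qed
  then show ?thesis
    using assms latin_on_transpose unfolding orthogonal_squares_def by blast
qed

lemma orthogonal_squaresD:
  assumes "orthogonal_squares t A B" "x < t" "y < t"
  shows "A x y < t" "B x y < t"
    "y' < t \<Longrightarrow> A x y = A x y' \<longleftrightarrow> y = y'" "y' < t \<Longrightarrow> B x y = B x y' \<longleftrightarrow> y = y'"
    "x' < t \<Longrightarrow> y' < t \<Longrightarrow> A x y = A x' y' \<Longrightarrow> B x y = B x' y' \<Longrightarrow> x = x' \<and> y = y'"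
proof -
  have "A x ` {..<t} \<subseteq> {..<t}" "B x ` {..<t} \<subseteq> {..<t}" "inj_on (A x) {..<t}" "inj_on (B x) {..<t}"
    using assms unfolding orthogonal_squares_def latin_on_def by auto
  then show "A x y < t" "B x y < t" "y' < t \<Longrightarrow> A x y = A x y' \<longleftrightarrow> y = y'" "y' < t \<Longrightarrow> B x y = B x y' \<longleftrightarrow> y = y'"
    using assms by (auto dest: inj_onD)
  assume "x' < t" "y' < t" "A x y = A x' y'" "B x y = B x' y'"
  moreover have "inj_on (\<lambda>(x, y). (A x y, B x y)) ({..<t} \<times> {..<t})"
    using assms unfolding orthogonal_squares_def by blast
  ultimately show "x = x' \<and> y = y'"
    using assms(2,3) by (auto dest!: inj_onD[of _ _ "(x, y)" "(x', y')"])
qed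

text \<open>For a Latin \<open>B\<close> and indices below \<open>t\<close> the solution is unique.
  Applied to the transposed square it solves for the row instead of the column.\<close>

definition solve_row :: "nat \<Rightarrow> (nat \<Rightarrow> nat \<Rightarrow> nat) \<Rightarrow> nat \<Rightarrow> nat \<Rightarrow> nat" where
  "solve_row t B l x = (SOME y. y < t \<and> B x y = l)"

lemma solve_row:
  assumes "latin_on {..<t} B" "x < t" "l < t"
  shows "solve_row t B l x < t" "B x (solve_row t B l x) = l"
proof -
  have "B x ` {..<t} = {..<t}"
    using assms unfolding latin_on_def by (intro endo_inj_surj) auto
  then have "\<exists>y. y < t \<and> B x y = l" using assms(3) by (metis imageE lessThan_iff)
  then show "solve_row t B l x < t" "B x (solve_row t B l x) = l"
    using someI_ex[of "\<lambda>y. y < t \<and> B x y = l"] unfolding solve_row_def by blast+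
qed

text \<open>The flag marks a block extended by a point at infinity. Its labels come from a cyclic
  square of order \<open>m + 1\<close> whose symbol \<open>m\<close> stands for that point. The
  shift by 1 makes the last row and column read \<open>0, ..., m\<close>; they become the border of
  the block at infinity.\<close>

definition cell_label :: "bool \<Rightarrow> nat \<Rightarrow> nat \<Rightarrow> nat \<Rightarrow> nat" where
  "cell_label b m i j = (if b then (i + j + 1) mod (m + 1) else (i + j) mod m)"

lemma mod_add_left_inj:
  fixes a :: nat
  assumes "(a + i) mod n = (a + j) mod n" "i < n" "j < n"
  shows "i = j"
  using assms cong_add_lcancel_nat[of a i j n] cong_less_modulus_unique_nat[of i j n]
  by (simp add: cong_def)

lemma cell_label_commute: "cell_label b m i j = cell_label b m j i"
  by (simp add: cell_label_def add.commute)

lemma cell_label_inj: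
  assumes "cell_label b m i j = cell_label b m i j'" "j < m" "j' < m"
  shows "j = j'"
  using assms mod_add_left_inj[of i j m j'] mod_add_left_inj[of "i + 1" j "m + 1" j']
  by (auto simp: cell_label_def split: if_splits)

lemma cell_label_le: "m > 0 \<Longrightarrow> cell_label b m i j \<le> m"
  unfolding cell_label_def using mod_less_divisor[of m "i + j"] mod_less_divisor[of "m + 1" "i + j + 1"] by auto

lemma cell_label_eq_top: "m > 0 \<Longrightarrow> cell_label b m i j = m \<Longrightarrow> b"
  unfolding cell_label_def using mod_less_divisor[of m "i + j"] by (metis less_irrefl)

text \<open>In row \<open>i\<close> of the cyclic square of order \<open>m + 1\<close> the symbol
  \<open>i\<close> stands in the last column, which is the border.\<close>

lemma cell_label_neq:
  assumes "i < m" "j < m"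
  shows "cell_label True m i j \<noteq> i"
proof
  assume "cell_label True m i j = i"
  then have "(i + (j + 1)) mod (m + 1) = (i + 0) mod (m + 1)"
    using assms by (simp add: cell_label_def)
  then show False
    using mod_add_left_inj[of i "j + 1" "m + 1" 0] assms by simp
qed

section \<open>The large square, its regions and their symbols\<close>

datatype point = Pt nat nat | Inf nat

definition points :: "nat \<Rightarrow> nat \<Rightarrow> nat \<Rightarrow> point set" where
  "points t m s = (\<lambda>(x, i). Pt x i) ` ({..<t} \<times> {..<m}) \<union> Inf ` {..<s}"

lemma points_iff [simp]: "Pt x i \<in> points t m s \<longleftrightarrow> x < t \<and> i < m" "Inf l \<in> points t m s \<longleftrightarrow> l < s"
  by (auto simp: points_def)

lemma finite_points: "finite (points t m s)"
  by (simp add: points_def)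

lemma card_points: "card (points t m s) = m * t + s"
proof -
  have "card ((\<lambda>(x, i). Pt x i) ` ({..<t} \<times> {..<m})) = t * m"
    by (subst card_image) (auto simp: inj_on_def)
  moreover have "card (Inf ` {..<s}) = s"
    by (simp add: card_image inj_on_def)
  ultimately show ?thesis
    unfolding points_def by (subst card_Un_disjoint) auto
qed

text \<open>Wilson's construction: the points of a transversal design with block size 4 get weight \<open>m\<close> in
  three groups, and \<open>s\<close> points of the fourth group, viewed as points at infinity, get weight 1.\<close>

fun wilson_square :: "nat \<Rightarrow> nat \<Rightarrow> nat \<Rightarrow> (nat \<Rightarrow> nat \<Rightarrow> nat) \<Rightarrow> (nat \<Rightarrow> nat \<Rightarrow> nat) \<Rightarrow> point \<Rightarrow> point \<Rightarrow> point" where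
  "wilson_square t m s A B (Pt x i) (Pt y j) =
     (let k = cell_label (B x y < s) m i j in if k = m then Inf (B x y) else Pt (A x y) k)"
| "wilson_square t m s A B (Pt x i) (Inf l) = Pt (A x (solve_row t B l x)) i"
| "wilson_square t m s A B (Inf l) (Pt y j) = Pt (A (solve_row t (\<lambda>x y. B y x) l y) y) j"
| "wilson_square t m s A B (Inf l) (Inf l') = Inf ((l + l') mod s)"

text \<open>The corner cells indexed by two points at infinity form a region of their own (with index
  \<open>None\<close>), except if \<open>G\<close> is a block whose point at infinity is \<open>0\<close>. Then this block, its extension and
  the corner cell at \<open>0\<close> form a subsquare of order \<open>m + 1\<close>, which is used as a region.\<close>

fun wilson_region :: "nat \<Rightarrow> nat \<Rightarrow> nat \<Rightarrow> (nat \<Rightarrow> nat \<Rightarrow> nat) \<Rightarrow> (nat \<times> nat) option \<Rightarrow> point \<Rightarrow> point \<Rightarrow>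
    (nat \<times> nat) option option" where
  "wilson_region t m s B G (Pt x i) (Pt y j) =
     (if cell_label (B x y < s) m i j = m \<and> G \<noteq> Some (x, y) then None else Some (Some (x, y)))"
| "wilson_region t m s B G (Pt x i) (Inf l) = Some (Some (x, solve_row t B l x))"
| "wilson_region t m s B G (Inf l) (Pt y j) = Some (Some (solve_row t (\<lambda>x y. B y x) l y, y))"
| "wilson_region t m s B G (Inf l) (Inf l') =
     (if G = None then Some None else if l = 0 \<and> l' = 0 then Some G else None)"

fun wilson_symbols :: "nat \<Rightarrow> nat \<Rightarrow> (nat \<Rightarrow> nat \<Rightarrow> nat) \<Rightarrow> (nat \<times> nat) option \<Rightarrow> (nat \<times> nat) option \<Rightarrow> point set" where
  "wilson_symbols m s A G None = Inf ` {..<s}"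
| "wilson_symbols m s A G (Some (x, y)) = Pt (A x y) ` {..<m} \<union> (if G = Some (x, y) then {Inf 0} else {})"

text \<open>\<open>B x y = 0\<close> pairs the distinguished block with the corner cell at 0, which
  holds \<open>Inf 0\<close> and exists because \<open>0 < s\<close>.\<close>

definition wilson_gadget :: "nat \<Rightarrow> nat \<Rightarrow> (nat \<Rightarrow> nat \<Rightarrow> nat) \<Rightarrow> (nat \<times> nat) option \<Rightarrow> bool" where
  "wilson_gadget t s B G \<longleftrightarrow> (case G of None \<Rightarrow> True | Some (x, y) \<Rightarrow> x < t \<and> y < t \<and> B x y = 0 \<and> 0 < s)"

lemma wilson_square_transpose:
  "wilson_square t m s A B i j = wilson_square t m s (\<lambda>x y. A y x) (\<lambda>x y. B y x) j i"
  by (cases i; cases j) (simp_all add: cell_label_commute[of _ m] add.commute)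

lemma wilson_region_transpose:
  "wilson_region t m s B G i j =
    map_option (map_option prod.swap) (wilson_region t m s (\<lambda>x y. B y x) (map_option prod.swap G) j i)"
  by (cases i; cases j; cases G) (auto simp: cell_label_commute[of _ m])

lemma wilson_symbols_transpose:
  "wilson_symbols m s A G (map_option prod.swap r) = wilson_symbols m s (\<lambda>x y. A y x) (map_option prod.swap G) r"
  by (cases r; cases G) auto

text \<open>In a row \<open>Pt x p\<close> a symbol determines the block through \<open>A\<close> or
  \<open>B\<close>, and then the cell through its label. In a row \<open>Inf k\<close> orthogonality
  recovers the block from its \<open>A\<close> and \<open>B\<close> values.\<close>

lemma wilson_square_row:
  assumes orth: "orthogonal_squares t A B" and st: "s \<le> t" and m: "m > 0"
    and i: "i \<in> points t m s"
  shows "wilson_square t m s A B i ` points t m s \<subseteq> points t m s"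
    and "inj_on (wilson_square t m s A B i) (points t m s)"
proof -
  let ?L = "wilson_square t m s A B" and ?I = "points t m s"
  note D = orthogonal_squaresD[OF orth]
  have B: "latin_on {..<t} B" "latin_on {..<t} (\<lambda>x y. B y x)"
    using orth latin_on_transpose unfolding orthogonal_squares_def by blast+
  have Y: "solve_row t B l x < t" "B x (solve_row t B l x) = l" if "x < t" "l < s" for l x
    using solve_row[OF B(1), of x l] that st by auto
  have X: "solve_row t (\<lambda>x y. B y x) l y < t" "B (solve_row t (\<lambda>x y. B y x) l y) y = l" if "y < t" "l < s" for l y
    using solve_row[OF B(2), of y l] that st by auto
  have label: "cell_label b m p q < m" if "cell_label b m p q \<noteq> m" for b p q
    using cell_label_le[OF m, of b p q] that by simp
  have "?L i j \<in> ?I" if "j \<in> ?I" for j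
    using i that cell_label_eq_top[OF m] label
    by (cases i; cases j) (auto simp: Let_def D X Y m)
  then show "?L i ` ?I \<subseteq> ?I" by blast
  \<comment> \<open>Equal symbols put both cells into the same block, which is then extended; but in
    row \<open>p\<close> the label \<open>p\<close> occurs only on the border.\<close>
  have mixed: False if "i = Pt x p" "j = Pt y q" "j' = Inf l" "j \<in> ?I" "j' \<in> ?I" "?L i j = ?L i j'" for x p j y q j' l
  proof -
    have lt: "x < t" "p < m" "y < t" "q < m" "l < s" using i that by auto
    have lab: "cell_label (B x y < s) m p q = p" and "A x y = A x (solve_row t B l x)"
      using that by (auto simp: Let_def split: if_splits)
    then have "y = solve_row t B l x" using D(3) Y lt by blast
    then have "B x y < s" using Y lt by simp
    then show False using lab cell_label_neq lt by simp
  qed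
  show "inj_on (?L i) ?I"
  proof (rule inj_onI)
    fix j j' assume j: "j \<in> ?I" "j' \<in> ?I" and eq: "?L i j = ?L i j'"
    show "j = j'"
    proof (cases i)
      case [simp]: (Pt x p)
      then have lt: "x < t" "p < m" using i by auto
      consider (pp) y q y' q' where "j = Pt y q" "j' = Pt y' q'"
        | (pi) y q l where "j = Pt y q \<and> j' = Inf l \<or> j' = Pt y q \<and> j = Inf l"
        | (ii) l l' where "j = Inf l" "j' = Inf l'" by (cases j; cases j') auto
      then show ?thesis
      proof cases
        case pp
        then have yt: "y < t" "q < m" "y' < t" "q' < m" using j by auto
        have "B x y = B x y' \<or> A x y = A x y'"
          using eq pp by (auto simp: Let_def split: if_splits)
        then have "y = y'" using D(3,4) lt yt by blast
        moreover from this have "cell_label (B x y < s) m p q = cell_label (B x y < s) m p q'"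
          using eq pp by (auto simp: Let_def split: if_splits)
        ultimately show ?thesis using cell_label_inj yt pp by blast
      next
        case pi
        then show ?thesis using mixed[OF Pt] j eq by metis
      next
        case ii
        then have "solve_row t B l x = solve_row t B l' x"
          using eq D(3) lt j Y by auto
        then show ?thesis using ii Y lt j by (metis points_iff(2))
      qed
    next
      case [simp]: (Inf k)
      then have k: "k < s" using i by auto
      consider (pp) y q y' q' where "j = Pt y q" "j' = Pt y' q'"
        | (pi) y q l where "j = Pt y q \<and> j' = Inf l \<or> j' = Pt y q \<and> j = Inf l"
        | (ii) l l' where "j = Inf l" "j' = Inf l'" by (cases j; cases j') auto
      then show ?thesis
      proof cases
        case pp
        then have yt: "y < t" "q < m" "y' < t" "q' < m" using j by auto
        \<comment> \<open>Both blocks have \<open>B\<close> value \<open>k\<close>, so equal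
          \<open>A\<close> values make them coincide.\<close>
        have "A (solve_row t (\<lambda>x y. B y x) k y) y = A (solve_row t (\<lambda>x y. B y x) k y') y'" "q = q'"
          using eq pp by auto
        then show ?thesis
          using pp D(5)[OF X(1)[OF yt(1) k] yt(1) X(1)[OF yt(3) k] yt(3)] X k yt by simp
      next
        case pi
        then show ?thesis using eq by auto
      next
        case ii
        then show ?thesis using eq j mod_add_left_inj[of k l s l'] by simp
      qed
    qed
  qed
qed

lemma latin_wilson_square:
  assumes "orthogonal_squares t A B" "s \<le> t" "m > 0"
  shows "latin_on (points t m s) (wilson_square t m s A B)"
proof -
  have "inj_on (\<lambda>j. wilson_square t m s A B j i) (points t m s)" if "i \<in> points t m s" for i
  proof -
    have "(\<lambda>j. wilson_square t m s A B j i) = wilson_square t m s (\<lambda>x y. A y x) (\<lambda>x y. B y x) i"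
      by (rule ext) (rule wilson_square_transpose)
    then show ?thesis
      using wilson_square_row(2)[OF orthogonal_squares_transpose[OF assms(1)] assms(2,3) that] by simp
  qed
  then show ?thesis
    unfolding latin_on_def using wilson_square_row[OF assms] by blast
qed

text \<open>Regions are renamed because transposition swaps the coordinates of a block.\<close>

lemma row_regions_map:
  assumes "row_regions I L g (\<lambda>r. T (f r))"
  shows "row_regions I L (\<lambda>i j. map_option f (g i j)) T"
  unfolding row_regions_def
proof (intro ballI allI impI)
  fix i j r assume I: "i \<in> I" "j \<in> I" and "map_option f (g i j) = Some r"
  then obtain q where q: "g i j = Some q" "r = f q" by auto
  show "L i j \<in> T r \<and> T r \<subseteq> I \<and> (\<forall>j'\<in>I. L i j' \<in> T r \<longrightarrow> map_option f (g i j') = Some r)"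
    using row_regionsD[OF assms I q(1)] q(2) by simp
qed

text \<open>In a row \<open>Pt x p\<close> the value \<open>A x y\<close> determines
  \<open>y\<close>; in a row \<open>Inf k\<close> the values \<open>A x y\<close> and
  \<open>B x y = k\<close> determine the block. So the finite symbols of a block stay within the
  block and its border along every row that meets it.\<close>

lemma wilson_region_row:
  assumes orth: "orthogonal_squares t A B" and st: "s \<le> t" and m: "m > 0" and G: "wilson_gadget t s B G"
  shows "row_regions (points t m s) (wilson_square t m s A B) (wilson_region t m s B G) (wilson_symbols m s A G)"
proof -
  let ?L = "wilson_square t m s A B" and ?I = "points t m s" and ?g = "wilson_region t m s B G"
    and ?T = "wilson_symbols m s A G"
  note D = orthogonal_squaresD[OF orth]
  have B: "latin_on {..<t} B" "latin_on {..<t} (\<lambda>x y. B y x)"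
    using orth latin_on_transpose unfolding orthogonal_squares_def by blast+
  have Y: "solve_row t B l x < t" "B x (solve_row t B l x) = l" if "x < t" "l < s" for l x
    using solve_row[OF B(1), of x l] that st by auto
  have X: "solve_row t (\<lambda>x y. B y x) l y < t" "B (solve_row t (\<lambda>x y. B y x) l y) y = l" if "y < t" "l < s" for l y
    using solve_row[OF B(2), of y l] that st by auto
  have label: "cell_label b m p q < m" if "cell_label b m p q \<noteq> m" for b p q
    using cell_label_le[OF m, of b p q] that by simp
  have G': "x < t" "y < t" "B x y = 0" "0 < s" if "G = Some (x, y)" for x y
    using G that by (auto simp: wilson_gadget_def)
  have member: "?L i j \<in> ?T r" if "i \<in> ?I" "j \<in> ?I" "?g i j = Some r" for i j r
    using that G' label by (cases i; cases j) (auto simp: Let_def split: if_splits)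
  have block: "x < t \<and> y < t" if "i \<in> ?I" "j \<in> ?I" "?g i j = Some (Some (x, y))" for i j x y
    using that G'(1,2)[of x y] X(1) Y(1) by (cases i; cases j) (auto split: if_splits)
  have valid: "?T r \<subseteq> ?I" if "i \<in> ?I" "j \<in> ?I" "?g i j = Some r" for i j r
  proof (cases r)
    case (Some p)
    then obtain x y where r: "r = Some (x, y)" by (cases p) auto
    with block[of i j x y] that have p: "r = Some (x, y)" "x < t" "y < t" by simp_all
    have "Pt (A x y) ` {..<m} \<subseteq> ?I" using D(1) p by auto
    moreover have "Inf 0 \<in> ?I" if "G = Some (x, y)" using G'(4)[OF that] by simp
    ultimately show ?thesis unfolding p(1) by simp
  qed auto
  have closed: "?g i j' = Some r"
    if ij: "i \<in> ?I" "j \<in> ?I" "j' \<in> ?I" and g: "?g i j = Some r" and L: "?L i j' \<in> ?T r" for i j j' r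
  proof (cases i)
    case [simp]: (Pt x p)
    then have xt: "x < t" using ij by auto
    \<comment> \<open>The corner region meets no row of a finite point, so \<open>r\<close> is a
      block in row \<open>x\<close>.\<close>
    obtain y where r [simp]: "r = Some (x, y)" and yt: "y < t"
      using g ij xt Y by (cases j) (auto split: if_splits)
    show ?thesis
    proof (cases j')
      case [simp]: (Pt y' q)
      have "y' < t" using ij by auto
      show ?thesis
        using L xt yt \<open>y' < t\<close> D(3)[of x y' y] D(4)[of x y' y] G'
        by (auto simp: Let_def split: if_splits)
    next
      case [simp]: (Inf l)
      have "l < s" using ij by auto
      then show ?thesis using L xt yt D(3)[of x "solve_row t B l x" y] Y[of x l]
        by (auto split: if_splits)
    qed
  next
    case [simp]: (Inf k)
    then have ks: "k < s" using ij by auto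
    show ?thesis
    proof (cases r)
      case None
      then have "G = None" using g by (cases j) (auto split: if_splits)
      then show ?thesis using L None by (cases j') auto
    next
      case r [simp]: (Some p)
      obtain x y where p [simp]: "p = (x, y)" by (cases p)
      have xy: "x < t" "y < t" "B x y = k" "G = Some (x, y) \<Longrightarrow> k = 0"
        using g ij ks X G' by (cases j; auto split: if_splits)+
      show ?thesis
      proof (cases j')
        case [simp]: (Pt y' q)
        then have "y' < t" using ij by auto
        then have "A (solve_row t (\<lambda>x y. B y x) k y') y' = A x y"
          using L by (auto split: if_splits)
        moreover have "B (solve_row t (\<lambda>x y. B y x) k y') y' = B x y"
          using X(2)[OF \<open>y' < t\<close> ks] xy(3) by simp
        ultimately have "solve_row t (\<lambda>x y. B y x) k y' = x \<and> y' = y"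
          by (rule D(5)[OF X(1)[OF \<open>y' < t\<close> ks] \<open>y' < t\<close> xy(1,2)])
        then show ?thesis by auto
      next
        case [simp]: (Inf l)
        then have "l < s" using ij by auto
        \<comment> \<open>The symbol can only be \<open>Inf 0\<close>, so the block is
          \<open>G\<close>, \<open>k = 0\<close>, and \<open>l = 0\<close> follows.\<close>
        then show ?thesis using L xy(4) by (auto split: if_splits)
      qed
    qed
  qed
  show ?thesis
    unfolding row_regions_def by (intro ballI allI impI conjI) (erule (2) member, erule (2) valid, rule closed)
qed

lemma wilson_region_col:
  assumes orth: "orthogonal_squares t A B" and st: "s \<le> t" and m: "m > 0" and G: "wilson_gadget t s B G"
  shows "row_regions (points t m s) (\<lambda>i j. wilson_square t m s A B j i) (\<lambda>i j. wilson_region t m s B G j i)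
    (wilson_symbols m s A G)"
proof -
  have "wilson_gadget t s (\<lambda>x y. B y x) (map_option prod.swap G)"
    using G by (auto simp: wilson_gadget_def split: option.splits)
  note row = wilson_region_row[OF orthogonal_squares_transpose[OF orth] st m this]
  show ?thesis
    unfolding wilson_square_transpose[of t m s A B] wilson_region_transpose[of t m s B G]
    by (rule row_regions_map) (use row in \<open>simp add: wilson_symbols_transpose\<close>)
qed

section \<open>Attainable cardinalities\<close>

definition wilson_cap :: "nat \<Rightarrow> nat \<Rightarrow> (nat \<times> nat) option \<Rightarrow> (nat \<times> nat) option \<Rightarrow> nat" where
  "wilson_cap m s G r = (case r of None \<Rightarrow> s | Some p \<Rightarrow> if G = Some p then m + 1 else m)"

text \<open>The blocks in the first column are never rotated, so every point remains an entry.\<close>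

definition wilson_rotatable :: "nat \<Rightarrow> (nat \<times> nat) option \<Rightarrow> (nat \<times> nat) option set" where
  "wilson_rotatable t G = Some ` ({..<t} \<times> {1..<t}) \<union> (if G = None then {None} else {})"

lemma finite_wilson_rotatable: "finite (wilson_rotatable t G)"
  by (simp add: wilson_rotatable_def)

lemma card_wilson_symbols: "card (wilson_symbols m s A G r) = wilson_cap m s G r"
proof (cases r)
  case None
  then show ?thesis by (simp add: wilson_cap_def card_image inj_on_def)
next
  case (Some p)
  obtain x y where p: "p = (x, y)" by (cases p)
  have "card (Pt (A x y) ` {..<m}) = m" by (simp add: card_image inj_on_def)
  moreover have "Inf 0 \<notin> Pt (A x y) ` {..<m}" by auto
  ultimately show ?thesis using Some p by (simp add: wilson_cap_def)
qed

text \<open>Added to the order \<open>m * t + s\<close>, the first total gives exactly the bound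
  \<open>m * t\<^sup>2 + 2 * s\<close>.\<close>

lemma sum_wilson_cap:
  "sum (wilson_cap m s None) (wilson_rotatable t None) = m * t * (t - 1) + s"
  "x < t \<Longrightarrow> y < t \<Longrightarrow> 1 \<le> y \<Longrightarrow>
    sum (wilson_cap m s (Some (x, y))) (wilson_rotatable t (Some (x, y))) = m * t * (t - 1) + 1"
proof -
  let ?B = "{..<t} \<times> {1..<t}"
  have "wilson_rotatable t None = Some ` ?B \<union> {None}"
    by (simp add: wilson_rotatable_def)
  then have "sum (wilson_cap m s None) (wilson_rotatable t None)
      = sum (wilson_cap m s None) (Some ` ?B) + sum (wilson_cap m s None) {None}"
    by (simp only:) (rule sum.union_disjoint, auto)
  also have "sum (wilson_cap m s None) (Some ` ?B) = (\<Sum>p\<in>?B. m)"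
    by (subst sum.reindex) (auto simp: wilson_cap_def)
  finally show "sum (wilson_cap m s None) (wilson_rotatable t None) = m * t * (t - 1) + s"
    by (simp add: wilson_cap_def algebra_simps)
  assume xy: "x < t" "y < t" "1 \<le> y"
  have "wilson_rotatable t (Some (x, y)) = Some ` ?B"
    by (simp add: wilson_rotatable_def)
  then have "sum (wilson_cap m s (Some (x, y))) (wilson_rotatable t (Some (x, y)))
      = (\<Sum>p\<in>?B. wilson_cap m s (Some (x, y)) (Some p))"
    by (simp only:) (subst sum.reindex, simp_all)
  also have "\<dots> = (\<Sum>p\<in>?B. m + (if p = (x, y) then 1 else 0))"
    by (rule sum.cong) (auto simp: wilson_cap_def)
  also have "\<dots> = m * t * (t - 1) + 1"
    using xy by (simp add: sum.distrib algebra_simps)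
  finally show "sum (wilson_cap m s (Some (x, y))) (wilson_rotatable t (Some (x, y))) = m * t * (t - 1) + 1" .
qed

lemma wilson_qls:
  assumes orth: "orthogonal_squares t A B" and st: "s \<le> t" and t: "t \<ge> 2" and m: "m > 0"
    and G: "wilson_gadget t s B G"
    and n: "\<And>r. r \<in> wilson_rotatable t G \<Longrightarrow> n r \<le> wilson_cap m s G r \<and> n r \<noteq> 1"
  shows "\<exists>\<Phi>. quantum_latin_square (m * t + s) \<Phi> \<and>
    qls_cardinality (m * t + s) \<Phi> = m * t + s + sum n (wilson_rotatable t G)"
proof -
  let ?L = "wilson_square t m s A B" and ?I = "points t m s" and ?g = "wilson_region t m s B G"
    and ?T = "wilson_symbols m s A G" and ?R = "wilson_rotatable t G"
  note D = orthogonal_squaresD[OF orth]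
  have B: "latin_on {..<t} A" "latin_on {..<t} B"
    using orth unfolding orthogonal_squares_def by blast+
  have Y: "solve_row t B (B x y) x = y" if "x < t" "y < t" for x y
    using solve_row[OF B(2) that(1), of "B x y"] D(2)[OF that] D(4)[of x y "solve_row t B (B x y) x"] that by simp
  \<comment> \<open>An extended block shows its finite symbols in its border column, any other block
    in its column \<open>Pt y 0\<close>.\<close>
  have block: "\<exists>i\<in>?I. \<exists>j\<in>?I. ?g i j = Some (Some (x, y)) \<and> ?L i j = Pt (A x y) k"
    if xy: "x < t" "y < t" "k < m" for x y k
  proof (cases "B x y < s")
    case True
    then show ?thesis
      using xy by (intro bexI[of _ "Pt x k"] bexI[of _ "Inf (B x y)"]) (simp_all add: Y)
  next
    case False
    then have "cell_label (B x y < s) m k 0 = k" using xy by (simp add: cell_label_def)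
    then show ?thesis
      using xy by (intro bexI[of _ "Pt x k"] bexI[of _ "Pt y 0"]) simp_all
  qed
  have "\<exists>\<Phi>. quantum_latin_square (card ?I) \<Phi> \<and> qls_cardinality (card ?I) \<Phi> = card ?I + sum n ?R"
  proof (rule qls_of_partial_regions[OF finite_points finite_wilson_rotatable latin_wilson_square[OF orth st m]
        wilson_region_row[OF orth st m G] wilson_region_col[OF orth st m G]])
    show "n r \<le> card (?T r) \<and> n r \<noteq> 1" if "r \<in> ?R" for r
      using n[OF that] by (simp add: card_wilson_symbols)
  next
    fix r a assume r: "r \<in> ?R" and a: "a \<in> ?T r"
    show "\<exists>i\<in>?I. \<exists>j\<in>?I. ?g i j = Some r \<and> ?L i j = a"
    proof (cases r)
      case None
      then obtain l where "G = None" "l < s" "a = Inf l"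
        using r a by (auto simp: wilson_rotatable_def split: if_splits)
      then show ?thesis
        using None by (intro bexI[of _ "Inf l"] bexI[of _ "Inf 0"]) simp_all
    next
      case (Some p)
      obtain x y where p: "p = (x, y)" by (cases p)
      have xy: "x < t" "y < t" using r Some p by (auto simp: wilson_rotatable_def split: if_splits)
      consider k where "k < m" "a = Pt (A x y) k" | "G = Some (x, y)" "a = Inf 0"
        using a Some p by (auto split: if_splits)
      then show ?thesis
      proof cases
        case 1
        then show ?thesis using block[OF xy] Some p by simp
      next
        case 2
        moreover have "0 < s" using 2 G by (simp add: wilson_gadget_def)
        ultimately show ?thesis
          using Some p by (intro bexI[of _ "Inf 0"]) simp_all
      qed
    qed
  next
    fix a assume a: "a \<in> ?I"
    show "\<exists>i\<in>?I. \<exists>j\<in>?I. ?g i j \<notin> Some ` ?R \<and> ?L i j = a"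
    proof (cases a)
      case (Pt k l)
      then have kl: "k < t" "l < m" using a by auto
      let ?x = "solve_row t (\<lambda>x y. A y x) k 0"
      have "?x < t" "A ?x 0 = k"
        using solve_row[OF latin_on_transpose[OF B(1)], of 0 k] kl t by auto
      moreover have "Some (Some (?x, 0)) \<notin> Some ` ?R"
        by (auto simp: wilson_rotatable_def split: if_splits)
      ultimately show ?thesis using block[of ?x 0 l] kl t Pt by (metis less_le_trans zero_less_numeral)
    next
      case (Inf l)
      then have l: "l < s" using a by simp
      \<comment> \<open>In a row that misses \<open>G\<close>, the block cells holding a symbol at
        infinity belong to no region.\<close>
      obtain x where x: "x < t" "\<And>y. G \<noteq> Some (x, y)"
      proof (cases "\<exists>y. G = Some (0, y)")
        case True
        then show thesis using t by (intro that[of 1]) auto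
      qed (use t in \<open>intro that[of 0]; auto\<close>)
      let ?y = "solve_row t B l x"
      have y: "?y < t" "B x ?y = l" using solve_row[OF B(2) x(1), of l] l st by auto
      have "cell_label True m 0 (m - 1) = m" using m by (simp add: cell_label_def)
      then show ?thesis
        using x y l m Inf
        by (intro bexI[of _ "Pt x 0"] bexI[of _ "Pt ?y (m - 1)"]) (auto simp: Let_def)
    qed
  qed
  then show ?thesis by (simp add: card_points)
qed

section \<open>Constructions over odd orders\<close>

text \<open>The second square is the first plus \<open>y\<close>, so the pair of values yields
  \<open>y\<close> and then \<open>x\<close>. Oddness makes 2 invertible, as the rows of the second
  square need.\<close>

lemma odd_orthogonal_squares:
  fixes t :: nat
  assumes "odd t"
  shows "orthogonal_squares t (\<lambda>x y. (x + y) mod t) (\<lambda>x y. (x + 2 * y) mod t)"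
proof -
  have pos: "t > 0" using assms by (cases t) auto
  have right: "x = x'" if "(x + y) mod t = (x' + y) mod t" "x < t" "x' < t" for x x' y :: nat
    using mod_add_left_inj[of y x t x'] that by (simp add: add.commute)
  have left: "y = y'" if "(x + y) mod t = (x + y') mod t" "y < t" "y' < t" for x y y' :: nat
    using mod_add_left_inj that by blast
  have double: "y = y'" if "(x + 2 * y) mod t = (x + 2 * y') mod t" "y < t" "y' < t" for x y y' :: nat
  proof -
    have "[2 * y = 2 * y'] (mod t)"
      using that(1) cong_add_lcancel_nat[of x "2 * y" "2 * y'" t] by (simp add: cong_def)
    then have "[y = y'] (mod t)"
      using cong_mult_lcancel_nat[of 2 t y y'] assms by (simp add: coprime_left_2_iff_odd)
    then show ?thesis using that cong_less_modulus_unique_nat by blast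
  qed
  have pair: "x = x' \<and> y = y'"
    if "(x + y) mod t = (x' + y') mod t" "(x + 2 * y) mod t = (x' + 2 * y') mod t"
      and lt: "x < t" "y < t" "x' < t" "y' < t" for x y x' y' :: nat
  proof -
    have "((x + y) + y) mod t = ((x' + y') + y') mod t"
      using that(2) by (simp add: mult_2 add.assoc)
    also have "\<dots> = ((x' + y') mod t + y') mod t" by (simp add: mod_add_left_eq)
    also have "\<dots> = ((x + y) mod t + y') mod t" by (simp only: that(1))
    also have "\<dots> = ((x + y) + y') mod t" by (simp add: mod_add_left_eq)
    finally have "y = y'" using left lt by blast
    then show ?thesis using right[of x y x'] that(1) lt by simp
  qed
  show ?thesis
    unfolding orthogonal_squares_def latin_on_def
  proof (intro conjI ballI)
    show "inj_on (\<lambda>(x, y). ((x + y) mod t, (x + 2 * y) mod t)) ({..<t} \<times> {..<t})"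
    proof (rule inj_onI, clarsimp)
      fix x y x' y' assume "x < t" "y < t" "x' < t" "y' < t"
        "(x + y) mod t = (x' + y') mod t" "(x + 2 * y) mod t = (x' + 2 * y') mod t"
      then show "x = x' \<and> y = y'" using pair by blast
    qed
  qed (use pos in \<open>auto intro!: inj_onI dest: left right double\<close>)
qed

text \<open>The corner is rotated along with the blocks. A region with three symbols makes every
  increment other than 1 reachable; if all regions have two symbols, only even increments
  arise.\<close>

lemma wilson_qls_corner:
  assumes "odd t" "s \<le> t" "t \<ge> 2" "m \<ge> 2" "s \<ge> 2"
    and "x \<noteq> 1" "x \<le> m * t * (t - 1) + s" "m \<ge> 3 \<or> s \<ge> 3 \<or> even x"
  shows "\<exists>\<Phi>. quantum_latin_square (m * t + s) \<Phi> \<and> qls_cardinality (m * t + s) \<Phi> = m * t + s + x"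
proof -
  let ?R = "wilson_rotatable t None" and ?cap = "wilson_cap m s None"
  have cap: "?cap r \<ge> 2" for r using assms by (simp add: wilson_cap_def split: option.split)
  have "\<exists>n. (\<forall>r\<in>?R. n r \<le> ?cap r \<and> n r \<noteq> 1) \<and> sum n ?R = x"
  proof (cases "m \<ge> 3 \<or> s \<ge> 3")
    case True
    have in_R: "None \<in> ?R" "Some (0, 1) \<in> ?R" using assms by (auto simp: wilson_rotatable_def)
    have "\<exists>r\<in>?R. ?cap r \<ge> 3"
      using True in_R by (auto simp: wilson_cap_def intro: bexI[of _ None] bexI[of _ "Some (0, 1)"])
    then show ?thesis
      using sum_with_bounds[OF finite_wilson_rotatable, of _ t None ?cap x] cap assms sum_wilson_cap(1)[of m s t]
      by auto
  next
    case False
    then have ms: "m = 2" "s = 2" and "even x" using assms by auto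
    have "2 * card ?R = (\<Sum>r\<in>?R. 2)" by simp
    also have "\<dots> = sum ?cap ?R"
      by (rule sum.cong) (auto simp: ms wilson_cap_def split: option.split)
    finally have "x \<le> 2 * card ?R" using assms by (simp add: sum_wilson_cap)
    then obtain n where "\<forall>r\<in>?R. n r \<le> 2 \<and> n r \<noteq> (1::nat)" "sum n ?R = x"
      using even_sum_with_bounds[OF finite_wilson_rotatable \<open>even x\<close>] by blast
    then show ?thesis using cap by (intro exI[of _ n]) (auto intro: order_trans)
  qed
  then obtain n where n: "\<forall>r\<in>?R. n r \<le> ?cap r \<and> n r \<noteq> 1" "sum n ?R = x" by blast
  show ?thesis
    using wilson_qls[OF odd_orthogonal_squares[OF assms(1)] assms(2,3), of m None n] n assms(4)
    by (simp add: wilson_gadget_def)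
qed

text \<open>Ordinary blocks have two symbols here; odd increments come from one distinguished block
  with three, for which a single point at infinity is enough.\<close>

lemma wilson_qls_gadget:
  assumes "odd t" "s \<le> t" "t \<ge> 2" "s \<ge> 1" and "x \<noteq> 1" "x \<le> 2 * t * (t - 1) + 1"
  shows "\<exists>\<Phi>. quantum_latin_square (2 * t + s) \<Phi> \<and> qls_cardinality (2 * t + s) \<Phi> = 2 * t + s + x"
proof -
  let ?B = "\<lambda>x y. (x + 2 * y) mod t"
  note orth = odd_orthogonal_squares[OF assms(1)]
  \<comment> \<open>The block \<open>(x0, 1)\<close> lies outside the unrotated first column and has
    point at infinity 0.\<close>
  define x0 where "x0 = solve_row t (\<lambda>x y. ?B y x) 0 1"
  have x0: "x0 < t" "?B x0 1 = 0"
    using solve_row[of t "\<lambda>x y. ?B y x" 1 0] latin_on_transpose orth assms(3)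
    unfolding orthogonal_squares_def x0_def by auto
  let ?G = "Some (x0, 1 :: nat)"
  let ?R = "wilson_rotatable t ?G" and ?cap = "wilson_cap 2 s ?G"
  have "?G \<in> ?R" using x0 assms by (auto simp: wilson_rotatable_def)
  moreover have "?cap ?G \<ge> 3" by (simp add: wilson_cap_def)
  moreover have "?cap r \<ge> 2" if "r \<in> ?R" for r
    using that by (auto simp: wilson_cap_def wilson_rotatable_def)
  moreover have "x \<le> sum ?cap ?R" using sum_wilson_cap(2)[of x0 t 1 2 s] x0 assms by simp
  ultimately obtain n where n: "\<forall>r\<in>?R. n r \<le> ?cap r \<and> n r \<noteq> 1" "sum n ?R = x"
    using sum_with_bounds[OF finite_wilson_rotatable, of ?G t ?G ?cap x] assms by blast
  show ?thesis
    using wilson_qls[OF orth assms(2,3), of 2 ?G n] n x0 assms by (simp add: wilson_gadget_def)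
qed

text \<open>This is the construction with \<open>s = 0\<close>: each rotatable block has 0 or 2
  symbols rotated, and the empty corner gets 0.\<close>

lemma doubled_qls:
  assumes "odd t" "t \<ge> 2" "even x" "x \<le> 2 * t * (t - 1)"
  shows "\<exists>\<Phi>. quantum_latin_square (2 * t) \<Phi> \<and> qls_cardinality (2 * t) \<Phi> = 2 * t + x"
proof -
  let ?R = "Some ` ({..<t} \<times> {1..<t})"
  have "card ?R = t * (t - 1)" by (simp add: card_image)
  then obtain n where n: "\<forall>r\<in>?R. n r \<le> 2 \<and> n r \<noteq> (1::nat)" "sum n ?R = x"
    using even_sum_with_bounds[of ?R x] assms by auto
  let ?n = "n(None := 0)"
  have R: "wilson_rotatable t None = insert None ?R" by (simp add: wilson_rotatable_def)
  have "sum ?n ?R = sum n ?R" by (intro sum.cong) auto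
  then have "sum ?n (wilson_rotatable t None) = x" unfolding R using n(2) by (subst sum.insert) auto
  moreover have "?n r \<le> wilson_cap 2 0 None r \<and> ?n r \<noteq> 1" if "r \<in> wilson_rotatable t None" for r
    using that n(1) unfolding R by (auto simp: wilson_cap_def)
  ultimately show ?thesis
    using wilson_qls[OF odd_orthogonal_squares[OF assms(1)] _ assms(2), of 0 2 None ?n]
    by (simp add: wilson_gadget_def)
qed

section \<open>Numerical bound and choice of parameters\<close>

text \<open>The right side is \<open>2 * u\<^sup>2 + k + 1\<close>, about half the square of the
  order. It is large enough since \<open>m \<ge> 3\<close> and \<open>t \<ge> 4\<close> make
  \<open>m * t\<close> at least \<open>2 * t + 4\<close>.\<close>

lemma even_block_bound:
  fixes t m s k u :: nat
  assumes t: "t \<ge> 4" and m: "m \<ge> 3" and s: "s \<ge> 2" and k: "k \<le> 4" and eq: "2 * u + k = m * t + s"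
  shows "m * t\<^sup>2 + 2 * s \<le> 2 * u + k + (2 * u * (u - 1) + 1)"
proof -
  \<comment> \<open>\<open>v\<close> is the value of \<open>2 * u\<close> in the extreme case
    \<open>k = 4\<close>; in general \<open>2 * u = v + d\<close>.\<close>
  define P v d where "P = int m * int t" and "v = P + int s - 4" and "d = 4 - int k"
  have "12 \<le> P" unfolding P_def using mult_mono[of 3 "int m" 4 "int t"] t m by simp
  have "0 \<le> P * ((int m - 2) * int t - 4)"
    using \<open>12 \<le> P\<close> mult_mono[of 1 "int m - 2" 4 "int t"] t m by simp
  then have P: "2 * (int m * int t ^ 2) \<le> P\<^sup>2 - 4 * P"
    by (simp add: P_def algebra_simps power2_eq_square)
  have "2 * (int s - 2) \<le> (P - 2) * (int s - 2)"
    using \<open>12 \<le> P\<close> s by (intro mult_right_mono) auto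
  moreover have "v\<^sup>2 = (P - 2)\<^sup>2 + 2 * ((P - 2) * (int s - 2)) + (int s - 2)\<^sup>2"
    by (simp add: v_def power2_eq_square algebra_simps)
  moreover have "(P - 2)\<^sup>2 = P\<^sup>2 - 4 * P + 4"
    by (simp add: power2_eq_square algebra_simps)
  ultimately have v: "P\<^sup>2 - 4 * P + 4 + 4 * (int s - 2) \<le> v\<^sup>2"
    using zero_le_power2[of "int s - 2"] by linarith
  \<comment> \<open>With squares and products as variables, the concluding estimate is
    linear.\<close>
  have arith: "2 * X + 4 * a \<le> 4 * u2 + 2 * b + 2"
    if "d \<le> w" "v2 + 2 * w \<le> 4 * u2" "2 * X \<le> P2 - 4 * P" "P2 - 4 * P + 4 + 4 * (a - 2) \<le> v2" "b = 4 - d"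
    for X a b d w P P2 u2 v2 :: int
    using that by simp
  have k_d: "int k = 4 - d" by (simp add: d_def)
  define w where "w = v * d"
  have "1 * d \<le> w"
    unfolding w_def using \<open>12 \<le> P\<close> s k by (intro mult_right_mono) (auto simp: v_def d_def)
  moreover have "2 * int u = v + d"
    using arg_cong[OF eq, of int] by (simp add: v_def d_def P_def)
  then have "(2 * int u)\<^sup>2 = v\<^sup>2 + 2 * w + d\<^sup>2"
    by (simp add: w_def power2_eq_square algebra_simps)
  then have "v\<^sup>2 + 2 * w \<le> 4 * (int u)\<^sup>2"
    by simp
  ultimately have "2 * (int m * int t ^ 2) + 4 * int s \<le> 4 * (int u)\<^sup>2 + 2 * int k + 2"
    using P v k_d by (intro arith[of d w "v\<^sup>2" "(int u)\<^sup>2" _ "P\<^sup>2" P]) simp_all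
  then have "int (m * t\<^sup>2 + 2 * s) \<le> int (2 * u\<^sup>2 + k + 1)" by simp
  then have "m * t\<^sup>2 + 2 * s \<le> 2 * u\<^sup>2 + k + 1" by linarith
  also have "2 * u\<^sup>2 + k + 1 = 2 * u + k + (2 * u * (u - 1) + 1)"
    by (cases u) (simp_all add: power2_eq_square)
  finally show ?thesis .
qed

theorem theorem4p3:
  fixes t s m c :: nat
  assumes "t \<ge> 2" and "t \<noteq> 2" and "t \<noteq> 6"
    and "2 \<le> s" and "s < t"
    and "m \<ge> 2"
    and "m * t + s \<le> c" and "c \<le> m * t^2 + 2 * s"
    and "c \<noteq> m * t + s + 1"
    and "\<not> (m = 2 \<and> s = 2 \<and> odd c \<and> 2 * t + 2 \<le> c \<and> c \<le> 2 * t^2 + 4)"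
  shows "\<exists>\<Phi>. quantum_latin_square (m * t + s) \<Phi> \<and> qls_cardinality (m * t + s) \<Phi> = c"
proof -
  define x where "x = c - (m * t + s)"
  have c: "c = m * t + s + x" and x1: "x \<noteq> 1" using assms by (auto simp: x_def)
  have sq: "m * t * (t - 1) + m * t = m * t^2"
    using assms(1) by (cases t) (simp_all add: power2_eq_square algebra_simps)
  have bound: "x \<le> m * t * (t - 1) + s" using assms(8) c sq by linarith
  have next_square: "2 * (t + 1) * t = 2 * t * (t - 1) + 4 * t" by (cases t) (simp_all add: algebra_simps)
  \<comment> \<open>Here \<open>c\<close> ranges over the excluded interval, so it is even, as is
    the order \<open>2 * t + 2\<close>.\<close>
  have even: "even x" if "m = 2" "s = 2"
    using assms(7,8,10) c that by auto
  consider (odd) "odd t" | (double) "even t" "m = 2" "s = 2" | (two) "even t" "m = 2" "s \<ge> 3"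
    | (ge3) "even t" "m \<ge> 3" using assms(4,6) by linarith
  then show ?thesis
  proof cases
    case odd
    have "m \<ge> 3 \<or> s \<ge> 3 \<or> even x" using even assms(4,6) by linarith
    then show ?thesis
      using wilson_qls_corner[OF odd _ assms(1,6,4) x1 bound] assms(5) unfolding c by simp
  next
    case double
    \<comment> \<open>The order \<open>2 * t + 2\<close> is twice the odd number
      \<open>t + 1\<close>, with no points at infinity left.\<close>
    have "x \<le> 2 * (t + 1) * t" using bound next_square assms(1) unfolding double by linarith
    then show ?thesis
      using doubled_qls[of "t + 1" x] even double assms(1) unfolding c by (simp add: algebra_simps)
  next
    case two
    \<comment> \<open>Over the odd number \<open>t + 1\<close> there remain
      \<open>s - 2 \<ge> 1\<close> points at infinity, enough for a distinguished block.\<close>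
    have "x \<le> 2 * (t + 1) * t + 1"
      using bound next_square assms(5) unfolding two by linarith
    moreover have "2 * (t + 1) + (s - 2) = 2 * t + s" using two by simp
    ultimately show ?thesis
      using wilson_qls_gadget[of "t + 1" "s - 2" x] two assms(1,5) x1 unfolding c by simp
  next
    case ge3
    have t4: "t \<ge> 4" using ge3 assms(1,2) by (cases "t = 3") auto
    have mt: "m * t \<ge> 12" using mult_le_mono[of 3 m 4 t] ge3 t4 by simp
    \<comment> \<open>For odd \<open>u\<close> the number \<open>2 * u\<close> is 2 modulo 4, so one
      of four consecutive values of \<open>k\<close> works; \<open>k \<ge> 1\<close> provides the
      point at infinity.\<close>
    have "\<exists>k u. 2 * u + k = v \<and> 1 \<le> k \<and> k \<le> 4 \<and> odd u" if "v \<ge> 6" for v :: nat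
      using that by presburger
    from this[of "m * t + s"] obtain k u where ku: "2 * u + k = m * t + s" "1 \<le> k" "k \<le> 4" "odd u"
      using mt by auto
    have u: "u \<ge> 5" using ku mt assms(4) by linarith
    have "x \<le> 2 * u * (u - 1) + 1"
      using even_block_bound[OF t4 ge3(2) assms(4) ku(3,1)] assms(8) c ku(1) by linarith
    then show ?thesis
      using wilson_qls_gadget[of u k x] ku u x1 unfolding c ku(1)[symmetric] by simp
  qed
qed

end
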